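(* If $T$ is a tree with $\beta_s(T)=3$, then $\tau_s(T)=2$.
   Context: For vertices $u,v,w$ of a connected graph, $w$ strongly resolves $u,v$ if there is a shortest $u$-$w$ path containing $v$ or a shortest $v$-$w$ path containing $u$. A strong resolving set is a set $W$ such that every pair of vertices is strongly resolved by some vertex of $W$; the strong dimension $\beta_s(H)$ is the minimum size of a strong resolving set of $H$. The threshold strong dimension $\tau_s(G)$ is the minimum of $\beta_s(H)$ over all graphs $H$ having $G$ as a spanning subgraph. *)

theory Defs
  imports "Graph_Theory.Digraph_Component"
begin

text \<open>
  Finite simple graphs are modelled by the locale \<open>pair_graph\<close>: finite, loop-free, symmetric
  digraphs whose arcs are pairs of vertices, so every undirected edge \<open>uv\<close> is present as the two
  arcs \<open>(u, v)\<close> and \<open>(v, u)\<close>. Arcs are taken to be pairs, rather than elements of an abstract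
  arc type, so that any two graphs on the same vertex set are \<open>compatible\<close>; \<open>spanning G H\<close> for
  such graphs just means that \<open>G\<close> and \<open>H\<close> have the same vertices and every edge of \<open>G\<close> is an
  edge of \<open>H\<close>.
\<close>

text \<open>
  The predicate \<open>tree\<close> of the library is unsuitable for symmetric digraphs: it counts
  the closed walk \<open>u, v, u\<close> along a single edge as a cycle. An undirected cycle has length
  at least 3.
\<close>

definition undirected_tree :: "'a pair_pre_digraph \<Rightarrow> bool" where
  "undirected_tree G \<longleftrightarrow> pair_graph G \<and> Digraph_Component.connected (with_proj G) \<and>
     \<not> (\<exists>c. pre_digraph.cycle (with_proj G) c \<and> 3 \<le> length c)"

definition shortest_path ::
  "'a pair_pre_digraph \<Rightarrow> 'a \<Rightarrow> ('a \<times> 'a) awalk \<Rightarrow> 'a \<Rightarrow> bool" where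
  "shortest_path G u p v \<longleftrightarrow> pre_digraph.apath (with_proj G) u p v \<and>
     (\<forall>q. pre_digraph.apath (with_proj G) u q v \<longrightarrow> length p \<le> length q)"

definition strongly_resolves :: "'a pair_pre_digraph \<Rightarrow> 'a \<Rightarrow> 'a \<Rightarrow> 'a \<Rightarrow> bool" where
  "strongly_resolves G w u v \<longleftrightarrow>
     (\<exists>p. shortest_path G u p w \<and> v \<in> set (pre_digraph.awalk_verts (with_proj G) u p)) \<or>
     (\<exists>p. shortest_path G v p w \<and> u \<in> set (pre_digraph.awalk_verts (with_proj G) v p))"

definition strong_resolving_set :: "'a pair_pre_digraph \<Rightarrow> 'a set \<Rightarrow> bool" where
  "strong_resolving_set G W \<longleftrightarrow> W \<subseteq> pverts G \<and>
     (\<forall>u \<in> pverts G. \<forall>v \<in> pverts G. u \<noteq> v \<longrightarrow> (\<exists>w \<in> W. strongly_resolves G w u v))"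

text \<open>
  In a finite connected graph the full vertex set is a strong resolving set, so the minimum
  below exists; for other graphs the value carries no meaning.
\<close>

definition strong_dim :: "'a pair_pre_digraph \<Rightarrow> nat" where
  "strong_dim G = (LEAST k. \<exists>W. strong_resolving_set G W \<and> card W = k)"

text \<open>
  \<open>spanning G H\<close> reads ``\<open>G\<close> is a spanning subgraph of \<open>H\<close>''. If \<open>G\<close> is connected, so is every
  such \<open>H\<close>.
\<close>

definition threshold_strong_dim :: "'a pair_pre_digraph \<Rightarrow> nat" where
  "threshold_strong_dim G =
     (LEAST k. \<exists>H. pair_graph H \<and> spanning (with_proj G) (with_proj H) \<and> strong_dim H = k)"

end

theory Submission
  imports Defs
begin

text \<open>
  The square of a path (positions adjacent when they differ by 1 or 2) has strong dimension at
  most 2: the first vertex and the last one in even position form a strong resolving set. So it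
  suffices to number the vertices of the tree such that adjacent numbers differ by at most 2.
  Strong dimension 3 means that at most two legs branch off a suitable path from \<open>a\<close> to \<open>b\<close>,
  one of them attached no further from \<open>a\<close> than the other. Give the path even numbers, let the
  first leg run towards \<open>a\<close> and the second towards \<open>b\<close> through the odd numbers.

  Conversely, in a graph strongly resolved by one vertex \<open>w\<close> the distance to \<open>w\<close> is injective
  and changes by at most 1 along edges, so \<open>w\<close> already strongly resolves every connected spanning
  subgraph.
\<close>

section \<open>Strong resolvability in tree metrics\<close>

text \<open>The shortest-path metric without its walks: adjacency is distance 1, and
  \<open>dist_step\<close> supplies the vertex just before \<open>v\<close> on a geodesic from
  \<open>u\<close>.\<close>

locale graph_metric =
  fixes V :: "'a set" and d :: "'a \<Rightarrow> 'a \<Rightarrow> nat"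
  assumes dist_eq_0: "\<lbrakk>u \<in> V; v \<in> V\<rbrakk> \<Longrightarrow> d u v = 0 \<longleftrightarrow> u = v"
    and dist_commute: "\<lbrakk>u \<in> V; v \<in> V\<rbrakk> \<Longrightarrow> d u v = d v u"
    and dist_triangle: "\<lbrakk>u \<in> V; v \<in> V; w \<in> V\<rbrakk> \<Longrightarrow> d u w \<le> d u v + d v w"
    and dist_step: "\<lbrakk>u \<in> V; v \<in> V; u \<noteq> v\<rbrakk> \<Longrightarrow> \<exists>z \<in> V. d z v = 1 \<and> d u v = d u z + 1"
begin

definition between :: "'a \<Rightarrow> 'a \<Rightarrow> 'a \<Rightarrow> bool" where
  "between u x v \<longleftrightarrow> d u x + d x v = d u v"

definition resolving :: "'a set \<Rightarrow> bool" where
  "resolving W \<longleftrightarrow> W \<subseteq> V \<and>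
     (\<forall>u \<in> V. \<forall>v \<in> V. u \<noteq> v \<longrightarrow> (\<exists>w \<in> W. between u v w \<or> between v u w))"

lemma between_commute:
  "\<lbrakk>u \<in> V; x \<in> V; v \<in> V\<rbrakk> \<Longrightarrow> between u x v \<longleftrightarrow> between v x u"
  by (auto simp: between_def dist_commute)

lemma between_trans:
  assumes "u \<in> V" "x \<in> V" "y \<in> V" "v \<in> V" "between u x y" "between u y v"
  shows "between u x v"
  using assms dist_triangle[of x y v] dist_triangle[of u x v] unfolding between_def by linarith

end

text \<open>\<open>between_split\<close>: deleting an inner vertex \<open>x\<close> of the path from
  \<open>p\<close> to \<open>q\<close> puts these into different components, so \<open>x\<close>
  separates any \<open>r\<close> from at least one of them. \<open>bipartite\<close>: trees have no
  odd cycles.\<close>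

locale tree_metric = graph_metric +
  assumes between_split:
      "\<lbrakk>p \<in> V; q \<in> V; r \<in> V; x \<in> V; between p x q\<rbrakk> \<Longrightarrow> between p x r \<or> between q x r"
    and bipartite: "\<lbrakk>r \<in> V; x \<in> V; y \<in> V; d x y = 1\<rbrakk> \<Longrightarrow> d r x \<noteq> d r y"
begin

text \<open>The interval between two vertices of a tree is a single path, on which the distance from
  \<open>a\<close> is a coordinate. Splitting at \<open>r\<close> = \<open>y\<close> forces
  \<open>d x y = 0\<close>.\<close>

lemma between_inj:
  assumes "a \<in> V" "b \<in> V" "x \<in> V" "y \<in> V" "between a x b" "between a y b" "d a x = d a y"
  shows "x = y"
proof -
  have "between a x y \<or> between b x y"
    using between_split assms by blast
  then have "d x y = 0"
    using assms by (auto simp: between_def dist_commute)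
  then show ?thesis using assms dist_eq_0 by blast
qed

text \<open>Leaving a tree path costs an even detour, so only an excess of exactly 1 has to be
  excluded. One step towards \<open>a\<close> lowers \<open>d a z\<close> by 1 and changes
  \<open>d z b\<close> by exactly 1; the excess would stay 1, against the induction hypothesis, or
  become -1, against the triangle inequality.\<close>

lemma dist_sum_not_between:
  assumes "a \<in> V" "b \<in> V" "z \<in> V" "\<not> between a z b"
  shows "d a b + 2 \<le> d a z + d z b"
proof -
  have "d a z + d z b \<noteq> d a b + 1" if "z \<in> V" for z
    using that
  proof (induction "d a z" arbitrary: z)
    case 0
    then show ?case using assms dist_eq_0[of a z] by simp
  next
    case (Suc n)
    then have "a \<noteq> z" using assms dist_eq_0[of a z] by auto
    then obtain z' where z': "z' \<in> V" "d z' z = 1" "d a z = d a z' + 1"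
      using dist_step Suc.prems assms by blast
    have "d a z' + d z' b \<noteq> d a b + 1" using Suc z' by simp
    moreover have "d z' b \<noteq> d z b"
      using bipartite[of b z' z] z' Suc.prems assms by (simp add: dist_commute)
    ultimately show ?case
      using z' assms Suc.prems dist_triangle[of a z' b] dist_triangle[of z' z b]
        dist_triangle[of z z' b] by (simp add: dist_commute)
  qed
  then show ?thesis
    using assms dist_triangle[of a z b] unfolding between_def
    by (metis (no_types, lifting) Suc_1 Suc_eq_plus1 add_Suc_right le_neq_implies_less not_less_eq_eq
        not_less)
qed

text \<open>
  \<open>C\<close> is the leg ending in \<open>l\<close>, the other leg ends in \<open>c\<close>. The two minimality assumptions select
  \<open>b\<close> as the vertex paired with \<open>l\<close> by the four-point condition, so that \<open>l\<close> branches off the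
  path from \<open>a\<close> to \<open>b\<close> no earlier than \<open>c\<close>.
\<close>

lemma ex_bandwidth_2_numbering_of_legs:
  fixes a b c l C defines "C \<equiv> {z \<in> V. \<not> between a z b \<and> \<not> between a z c}"
  assumes V: "a \<in> V" "b \<in> V" "c \<in> V" "l \<in> V"
    and chain: "\<And>z. z \<in> C \<Longrightarrow> between a z l \<and> between b z l"
    and minc: "d b l + d a c \<le> d c l + d a b"
    and mina: "d b l + d a c \<le> d a l + d b c"
  shows "\<exists>K :: 'a \<Rightarrow> int. inj_on K V \<and> (\<forall>u \<in> V. \<forall>v \<in> V. d u v = 1 \<longrightarrow> \<bar>K u - K v\<bar> \<le> 2)"
proof -
  \<comment> \<open>The spine from \<open>a\<close> to \<open>b\<close>, and the leg towards
    \<open>c\<close> without its foot on the spine.\<close>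
  define S where "S = {z \<in> V. between a z b}"
  define Y where "Y = {z \<in> V. between a z c \<and> \<not> between a z b}"
  have SV: "S \<subseteq> V" and YV: "Y \<subseteq> V" and CV: "C \<subseteq> V" by (auto simp: S_def Y_def C_def)
  have Veq: "V = S \<union> Y \<union> C" by (auto simp: S_def Y_def C_def)
  have Ybc: "between b y c" if "y \<in> Y" for y
    using between_split[of a c b y] that V by (auto simp: Y_def between_commute)
  \<comment> \<open>Otherwise \<open>y\<close> lies on the paths from both \<open>a\<close> and
    \<open>b\<close> to \<open>l\<close>, so \<open>c\<close> and \<open>l\<close> branch off
    together and \<open>d c l + d a b\<close> is the smaller sum, against
    \<open>minc\<close>.\<close>
  have sep: "\<not> between a y z" if "y \<in> Y" "z \<in> C" for y z
  proof
    assume *: "between a y z"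
    have in_V: "y \<in> V" "z \<in> V" using that YV CV by auto
    have al: "between a y l" using between_trans[OF _ _ _ _ *] chain that V in_V by blast
    then have "between b y l"
      using between_split[of a l b y] that V by (auto simp: Y_def between_commute)
    moreover have "between a y c" "d a b < d a y + d y b"
      using that dist_triangle[of a y b] V by (auto simp: Y_def between_def)
    moreover have "d c l \<le> d y c + d y l"
      using dist_triangle[of c y l] V in_V by (simp add: dist_commute)
    ultimately show False using minc in_V V by (simp add: between_def dist_commute)
  qed
  \<comment> \<open>Cutting off the common ends beyond \<open>z\<close> and \<open>y\<close> turns
    \<open>mina\<close> into a comparison of two sums. Together they are at least
    \<open>2 * d a b + 4\<close>, because both vertices lie off the spine, so the larger one is at
    least half of that.\<close>
  have gap: "d a b + 2 \<le> d a z + d b y" if "y \<in> Y" "z \<in> C" for y z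
  proof -
    have in_V: "y \<in> V" "z \<in> V" using that YV CV by auto
    have "d b z + d a y \<le> d a z + d b y"
      using mina chain[OF that(2)] Ybc[OF that(1)] that(1)
      unfolding Y_def between_def by simp
    moreover have "d a b + 2 \<le> d a z + d b z" "d a b + 2 \<le> d a y + d b y"
      using dist_sum_not_between[of a b z] dist_sum_not_between[of a b y] that V in_V
      by (auto simp: C_def Y_def dist_commute)
    ultimately show ?thesis by linarith
  qed
  \<comment> \<open>The spine takes even numbers. Leg \<open>C\<close> is measured from
    \<open>a\<close> and ascends through odd numbers; leg \<open>Y\<close> is measured from
    \<open>b\<close> and descends. \<open>Y\<close> may run past \<open>a\<close> into negative
    numbers, hence the type \<open>int\<close>.\<close>
  define K :: "'a \<Rightarrow> int" where
    "K v = (if v \<in> S then 2 * int (d a v) else if v \<in> C then 2 * int (d a v) - 1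
            else 2 * int (d a b) - 2 * int (d b v) + 1)" for v
  have KS: "K v = 2 * int (d a v)" "K v = 2 * int (d a b) - 2 * int (d b v)" if "v \<in> S" for v
    using that V by (auto simp: K_def S_def between_def dist_commute)
  have KC: "K v = 2 * int (d a v) - 1" if "v \<in> C" for v
    using that by (auto simp: K_def S_def C_def)
  have KY: "K v = 2 * int (d a b) - 2 * int (d b v) + 1" if "v \<in> Y" for v
    using that by (auto simp: K_def S_def C_def Y_def)
  have lip: "d r v \<le> d r u + 1" if "r \<in> V" "u \<in> V" "v \<in> V" "d u v = 1" for r u v
    using dist_triangle[of r u v] that by simp
  have "inj_on K V"
  proof (rule inj_onI)
    have SS: "u = v" if "K u = K v" "u \<in> S" "v \<in> S" for u v
      using that KS between_inj[of a b u v] V by (auto simp: S_def)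
    have CC: "u = v" if "K u = K v" "u \<in> C" "v \<in> C" for u v
      using that KC between_inj[of a l u v] V chain CV by auto
    have YY: "u = v" if "K u = K v" "u \<in> Y" "v \<in> Y" for u v
      using that KY between_inj[of b c u v] V Ybc YV by auto
    have SC: False if "K u = K v" "u \<in> S" "v \<in> C" for u v
      using that(1) KS(1)[OF that(2)] KC[OF that(3)] by presburger
    have SY: False if "K u = K v" "u \<in> S" "v \<in> Y" for u v
      using that(1) KS(1)[OF that(2)] KY[OF that(3)] by presburger
    \<comment> \<open>Parity does not separate the two legs; \<open>gap\<close> keeps every number
      of \<open>Y\<close> below every number of \<open>C\<close>.\<close>
    have YC: False if "K u = K v" "u \<in> Y" "v \<in> C" for u v
      using that(1) KY[OF that(2)] KC[OF that(3)] gap[OF that(2,3)] by linarith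
    fix u v assume "u \<in> V" "v \<in> V" "K u = K v"
    then show "u = v" unfolding Veq using SS CC YY SC SY YC by (metis Un_iff)
  qed
  moreover have "\<bar>K u - K v\<bar> \<le> 2" if uv: "u \<in> V" "v \<in> V" "d u v = 1" for u v
  proof -
    have vu: "d v u = 1" using uv by (simp add: dist_commute)
    have SS: ?thesis if "u \<in> S" "v \<in> S"
      using KS(1)[OF that(1)] KS(1)[OF that(2)] lip[of a u v] lip[of a v u] uv vu V by linarith
    have CC: ?thesis if "u \<in> C" "v \<in> C"
      using KC[OF that(1)] KC[OF that(2)] lip[of a u v] lip[of a v u] uv vu V by linarith
    have YY: ?thesis if "u \<in> Y" "v \<in> Y"
      using KY[OF that(1)] KY[OF that(2)] lip[of b u v] lip[of b v u] uv vu V by linarith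
    have SC: "\<bar>K u - K v\<bar> \<le> 2" if "u \<in> S" "v \<in> C" "d u v = 1" for u v
    proof -
      have in_V: "u \<in> V" "v \<in> V" using that SV CV by auto
      then have vu: "d v u = 1" using that by (simp add: dist_commute)
      have "\<not> between a v u"
        using that V in_V between_commute between_trans[of a v u b] by (auto simp: S_def C_def)
      then have "d a u \<le> d a v"
        using lip[of a v u] vu V in_V by (auto simp: between_def)
      then show ?thesis using KS(1)[OF that(1)] KC[OF that(2)] lip[of a u v] that(3) V in_V by linarith
    qed
    have SY: "\<bar>K u - K v\<bar> \<le> 2" if "u \<in> S" "v \<in> Y" "d u v = 1" for u v
    proof -
      have in_V: "u \<in> V" "v \<in> V" using that SV YV by auto
      then have vu: "d v u = 1" using that by (simp add: dist_commute)
      have "\<not> between b v u"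
        using that V in_V between_commute between_trans[of b v u a] by (auto simp: S_def Y_def)
      then have "d b u \<le> d b v"
        using lip[of b v u] vu V in_V by (auto simp: between_def)
      then show ?thesis using KS(2)[OF that(1)] KY[OF that(2)] lip[of b u v] that(3) V in_V by linarith
    qed
    \<comment> \<open>Adjacent vertices differ in their distance from \<open>a\<close>. If
      \<open>v\<close> is the farther one, \<open>sep\<close> is violated; if \<open>u\<close> is,
      then \<open>v\<close> lies on the path from \<open>a\<close> to \<open>c\<close> and not in
      \<open>C\<close>.\<close>
    have YC: False if "u \<in> Y" "v \<in> C" "d u v = 1" for u v
    proof -
      have in_V: "u \<in> V" "v \<in> V" using that YV CV by auto
      then have vu: "d v u = 1" using that by (simp add: dist_commute)
      have "d a v \<noteq> d a u + 1" using sep[OF that(1,2)] that(3) by (auto simp: between_def)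
      moreover have "d a v \<noteq> d a u" using bipartite[of a v u] vu V in_V by auto
      ultimately have "between a v u"
        using lip[of a u v] lip[of a v u] vu that(3) V in_V by (auto simp: between_def)
      then have "between a v c" using between_trans[of a v u c] that V in_V by (auto simp: Y_def)
      then show False using that by (auto simp: C_def)
    qed
    show ?thesis
      using uv vu SS CC YY SC[of u v] SC[of v u] SY[of u v] SY[of v u] YC[of u v] YC[of v u]
      unfolding Veq by (auto simp: abs_minus_commute)
  qed
  ultimately show ?thesis by blast
qed

text \<open>\<open>C\<close> collects the vertices off the subtree spanned by the three resolving
  vertices. Strong resolution lines them up on one path ending in \<open>l\<close>, the member of
  \<open>C\<close> farthest from \<open>w1\<close>. The smallest of the three pair sums on
  \<open>w1\<close>, \<open>w2\<close>, \<open>w3\<close>, \<open>l\<close> then tells which vertex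
  plays the role of \<open>b\<close>.\<close>

lemma ex_bandwidth_2_numbering:
  assumes fin: "finite V" and res: "resolving {w1, w2, w3}"
  shows "\<exists>K :: 'a \<Rightarrow> int. inj_on K V \<and> (\<forall>u \<in> V. \<forall>v \<in> V. d u v = 1 \<longrightarrow> \<bar>K u - K v\<bar> \<le> 2)"
proof -
  have V: "w1 \<in> V" "w2 \<in> V" "w3 \<in> V" using res by (auto simp: resolving_def)
  define C where "C = {z \<in> V. \<forall>a \<in> {w1, w2, w3}. \<forall>b \<in> {w1, w2, w3}. \<not> between a z b}"
  have C: "z \<in> C" if "{a, b, c} = {w1, w2, w3}" "z \<in> V" "\<not> between a z b" "\<not> between a z c" for a b c z
  proof -
    have in_V: "a \<in> V" "b \<in> V" "c \<in> V" using that V by auto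
    have "\<not> between x z x" if "x \<in> V" "z \<noteq> x" for x
      using that dist_eq_0[of x x] dist_eq_0[of x z] \<open>z \<in> V\<close> by (auto simp: between_def)
    moreover have "z \<noteq> a" "z \<noteq> b" "z \<noteq> c"
      using that in_V dist_eq_0[of a a] dist_eq_0[of b b] dist_eq_0[of c c] by (auto simp: between_def)
    \<comment> \<open>Splitting the path from \<open>b\<close> to \<open>c\<close> at
      \<open>a\<close> would put \<open>z\<close> on one of the two paths already excluded.\<close>
    moreover have "\<not> between b z c"
      using between_split[of b c a z] that in_V by (auto simp: between_commute)
    ultimately have "\<forall>x \<in> {a, b, c}. \<forall>y \<in> {a, b, c}. \<not> between x z y"
      using that(2-4) in_V by (auto simp: between_commute)
    then show ?thesis using \<open>z \<in> V\<close> unfolding C_def that(1)[symmetric] by blast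
  qed
  obtain l where l: "l \<in> V" and chain: "\<And>z w. z \<in> C \<Longrightarrow> w \<in> {w1, w2, w3} \<Longrightarrow> between w z l"
  proof (cases "C = {}")
    \<comment> \<open>With \<open>C\<close> empty, any vertex can serve as \<open>l\<close>.\<close>
    case True
    then show ?thesis using that V by blast
  next
    case False
    have finC: "finite C" using fin by (auto simp: C_def)
    then have "Max (d w1 ` C) \<in> d w1 ` C" using False by simp
    then obtain l where l: "l \<in> C" "d w1 l = Max (d w1 ` C)" by auto
    have max: "d w1 z \<le> d w1 l" if "z \<in> C" for z using l finC that by simp
    have lV: "l \<in> V" using l by (auto simp: C_def)
    have "between w z l" if z: "z \<in> C" and w: "w \<in> {w1, w2, w3}" for z w
    proof (cases "z = l")
      case True
      then show ?thesis using lV dist_eq_0[of l l] by (simp add: between_def)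
    next
      case False
      have zV: "z \<in> V" using z by (auto simp: C_def)
      \<comment> \<open>A vertex of \<open>C\<close> separates no two resolving vertices, so if it
        separates \<open>y\<close> from one of them, it separates \<open>y\<close> from all.\<close>
      have shift: "between w x y"
        if "x \<in> C" "y \<in> C" "w \<in> {w1, w2, w3}" "v \<in> {w1, w2, w3}" "between y x v" for x y w v
      proof -
        have "x \<in> V" "y \<in> V" "w \<in> V" "v \<in> V" using that V by (auto simp: C_def)
        moreover have "\<not> between v x w" using that by (auto simp: C_def)
        ultimately show ?thesis using between_split[of y v w x] that by (auto simp: between_commute)
      qed
      obtain v where v: "v \<in> {w1, w2, w3}" "between z l v \<or> between l z v"
        using res zV lV False unfolding resolving_def by blast
      have "\<not> between z l v"
      proof
        assume "between z l v"
        then have "between w1 l z" using shift[of l z w1 v] l z v by auto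
        then have "d l z = 0" using max[OF z] by (auto simp: between_def)
        then show False using False dist_eq_0 zV lV by auto
      qed
      then show ?thesis using shift[of z l w v] v z l w by blast
    qed
    then show ?thesis using that lV by blast
  qed
  have main: ?thesis if "{a, b, c} = {w1, w2, w3}" "d b l + d a c \<le> d c l + d a b"
    "d b l + d a c \<le> d a l + d b c" for a b c
  proof (rule ex_bandwidth_2_numbering_of_legs[of a b c l])
    show "a \<in> V" "b \<in> V" "c \<in> V" using that V by auto
  next
    fix z assume "z \<in> {z \<in> V. \<not> between a z b \<and> \<not> between a z c}"
    then have "z \<in> C" using C[OF that(1)] by auto
    moreover have "a \<in> {w1, w2, w3}" "b \<in> {w1, w2, w3}" using that by auto
    ultimately show "between a z l \<and> between b z l" using chain by blast
  qed (use that l in auto)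
  \<comment> \<open>The vertex paired with \<open>l\<close> in the smallest sum becomes
    \<open>b\<close>; the other two become \<open>a\<close> and \<open>c\<close>.\<close>
  consider "d w1 l + d w2 w3 \<le> d w2 l + d w1 w3" "d w1 l + d w2 w3 \<le> d w3 l + d w1 w2"
    | "d w2 l + d w1 w3 \<le> d w1 l + d w2 w3" "d w2 l + d w1 w3 \<le> d w3 l + d w1 w2"
    | "d w3 l + d w1 w2 \<le> d w1 l + d w2 w3" "d w3 l + d w1 w2 \<le> d w2 l + d w1 w3"
    by linarith
  then show ?thesis
  proof cases
    case 1
    then show ?thesis using main[of w2 w1 w3] V by (auto simp: dist_commute insert_commute)
  next
    case 2
    then show ?thesis using main[of w1 w2 w3] V by (auto simp: dist_commute)
  next
    case 3
    then show ?thesis using main[of w1 w3 w2] V by (auto simp: dist_commute insert_commute)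
  qed
qed

end

section \<open>Distances in connected graphs\<close>

locale connected_pair_graph = pair_graph +
  assumes conn: "connected (with_proj G)"
begin

text \<open>Minimizing over walks instead of paths makes concatenation immediate;
  \<open>apath_if_geodesic\<close> shows that the minimum is the same.\<close>

definition gdist :: "'a \<Rightarrow> 'a \<Rightarrow> nat" where
  "gdist u v = (LEAST n. \<exists>p. awalk u p v \<and> length p = n)"

lemma ex_geodesic:
  assumes "u \<in> pverts G" "v \<in> pverts G"
  obtains p where "awalk u p v" "length p = gdist u v"
proof -
  have "strongly_connected (with_proj G)"
    using symmetric_connected_imp_strongly_connected[OF _ conn] pair_sym_arcs by simp
  then have "u \<rightarrow>\<^sup>*\<^bsub>G\<^esub> v" using assms by (auto simp: strongly_connected_def)
  then have "\<exists>n p. awalk u p v \<and> length p = n" unfolding reachable_awalk by blast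
  then have "\<exists>p. awalk u p v \<and> length p = gdist u v" unfolding gdist_def by (rule LeastI_ex)
  then show ?thesis using that by blast
qed

lemma gdist_le: "awalk u p v \<Longrightarrow> gdist u v \<le> length p"
  unfolding gdist_def by (rule Least_le) blast

lemma gdist_self: "u \<in> pverts G \<Longrightarrow> gdist u u = 0"
  using gdist_le[of u "[]" u] by (simp add: awalk_Nil_iff)

lemma gdist_eq_0: "\<lbrakk>u \<in> pverts G; v \<in> pverts G\<rbrakk> \<Longrightarrow> gdist u v = 0 \<longleftrightarrow> u = v"
  by (metis awalk_empty_ends ex_geodesic gdist_self length_0_conv)

lemma gdist_triangle:
  assumes "u \<in> pverts G" "v \<in> pverts G" "w \<in> pverts G"
  shows "gdist u w \<le> gdist u v + gdist v w"
proof -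
  obtain p q where "awalk u p v" "length p = gdist u v" "awalk v q w" "length q = gdist v w"
    using assms ex_geodesic by metis
  then show ?thesis using gdist_le[of u "p @ q" w] awalk_appendI[of u p v q w] by simp
qed

lemma gdist_arc_le: "(u, v) \<in> parcs G \<Longrightarrow> gdist u v \<le> 1"
  using gdist_le[of u "[(u, v)]" v] in_arcsD2 by (simp add: awalk_simps)

lemma arc_sym: "(u, v) \<in> parcs G \<Longrightarrow> (v, u) \<in> parcs G"
  using graph_symmetric by simp

lemma gdist_arc: "(u, v) \<in> parcs G \<Longrightarrow> gdist u v = 1"
  using gdist_arc_le gdist_eq_0[of u v] in_arcsD1[of u v] in_arcsD2[of u v] pair_no_loops[of "(u, v)"]
  by fastforce

lemma arc_if_gdist_1:
  assumes "u \<in> pverts G" "v \<in> pverts G" "gdist u v = 1"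
  shows "(u, v) \<in> parcs G"
proof -
  obtain p where p: "awalk u p v" "length p = 1" using ex_geodesic assms by metis
  then obtain e where "p = [e]" by (auto simp: length_Suc_conv)
  then show ?thesis using p by (auto simp: awalk_simps)
qed

lemma gdist_step:
  assumes "u \<in> pverts G" "v \<in> pverts G" "u \<noteq> v"
  obtains z where "(u, z) \<in> parcs G" "gdist u v = gdist z v + 1"
proof -
  obtain p where p: "awalk u p v" "length p = gdist u v" using ex_geodesic assms by metis
  then obtain e q where eq: "p = e # q" using assms gdist_eq_0 by (cases p) auto
  then have e: "e = (u, snd e)" "(u, snd e) \<in> parcs G" and q: "awalk (snd e) q v"
    using p by (auto simp: awalk_Cons_iff)
  have "gdist u v \<le> gdist u (snd e) + gdist (snd e) v"
    using gdist_triangle[of u "snd e" v] assms e in_arcsD2 by blast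
  then have "gdist u v = gdist (snd e) v + 1"
    using gdist_le[OF q] gdist_arc_le[OF e(2)] p eq by simp
  then show ?thesis using that e by blast
qed

lemma gdist_sym_le:
  assumes "u \<in> pverts G" "v \<in> pverts G"
  shows "gdist v u \<le> gdist u v"
  using assms
proof (induction "gdist u v" arbitrary: u)
  case 0
  then show ?case using gdist_eq_0[of u v] gdist_self by simp
next
  case (Suc n)
  then have "u \<noteq> v" using gdist_self by auto
  then obtain z where z: "(u, z) \<in> parcs G" "gdist u v = gdist z v + 1"
    using gdist_step Suc.prems by blast
  then have "gdist v z \<le> gdist z v" using Suc in_arcsD2 by simp
  moreover have "gdist v u \<le> gdist v z + gdist z u"
    using gdist_triangle Suc.prems in_arcsD2 z by blast
  ultimately show ?case using gdist_arc_le[OF arc_sym[OF z(1)]] z by simp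
qed

lemma gdist_commute: "\<lbrakk>u \<in> pverts G; v \<in> pverts G\<rbrakk> \<Longrightarrow> gdist u v = gdist v u"
  using gdist_sym_le by (simp add: le_antisym)

sublocale graph_metric "pverts G" gdist
proof
  fix u v assume uv: "u \<in> pverts G" "v \<in> pverts G" "u \<noteq> v"
  then obtain z where z: "(v, z) \<in> parcs G" "gdist v u = gdist z u + 1"
    using gdist_step by metis
  then have "z \<in> pverts G" "gdist z v = 1" using gdist_arc arc_sym in_arcsD2 by auto
  then show "\<exists>z\<in>pverts G. gdist z v = 1 \<and> gdist u v = gdist u z + 1"
    using z uv gdist_commute by metis
qed (use gdist_eq_0 gdist_commute gdist_triangle in auto)

text \<open>A repeated vertex encloses a closed subwalk; cutting it out would give a shorter
  walk.\<close>

lemma apath_if_geodesic: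
  assumes "awalk u p v" "length p = gdist u v"
  shows "apath u p v"
proof (rule ccontr)
  assume "\<not> apath u p v"
  then have "\<not> distinct (pawalk_verts u p)" using assms by (simp add: apath_def)
  then obtain q r s w where p: "p = q @ r @ s" and r: "awalk w r w" "r \<noteq> []"
    and walks: "awalk u q w" "awalk w s v"
    using awalk_not_distinct_decomp[OF assms(1)] by auto
  then have "length (q @ s) < length p" by simp
  then show False using gdist_le[OF awalk_appendI[OF walks]] assms(2) by simp
qed

lemma shortest_path_iff:
  "shortest_path G u p v \<longleftrightarrow> awalk u p v \<and> length p = gdist u v"
proof
  assume sp: "shortest_path G u p v"
  then have p: "awalk u p v" by (auto simp: shortest_path_def apath_def)
  then have "u \<in> pverts G" "v \<in> pverts G" by auto
  then obtain q where "awalk u q v" "length q = gdist u v" using ex_geodesic by metis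
  then have "length p \<le> gdist u v" using apath_if_geodesic sp by (metis shortest_path_def)
  then show "awalk u p v \<and> length p = gdist u v" using gdist_le[OF p] p by simp
next
  assume "awalk u p v \<and> length p = gdist u v"
  then show "shortest_path G u p v"
    using apath_if_geodesic gdist_le awalkI_apath by (auto simp: shortest_path_def)
qed

text \<open>Cutting a geodesic at \<open>v\<close> gives two walks, and gluing two geodesics at
  \<open>v\<close> gives one. This reduces strong resolution to equations between distances.\<close>

lemma on_shortest_path_iff:
  assumes "u \<in> pverts G" "v \<in> pverts G" "w \<in> pverts G"
  shows "(\<exists>p. shortest_path G u p w \<and> v \<in> set (pawalk_verts u p)) \<longleftrightarrow> between u v w"
proof
  assume "\<exists>p. shortest_path G u p w \<and> v \<in> set (pawalk_verts u p)"
  then obtain p where p: "awalk u p w" "length p = gdist u w" "v \<in> set (pawalk_verts u p)"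
    by (auto simp: shortest_path_iff)
  then obtain q r where "p = q @ r" "awalk u q v" "awalk v r w" using awalk_decomp by blast
  then show "between u v w"
    using p gdist_le[of u q v] gdist_le[of v r w] gdist_triangle[OF assms] by (simp add: between_def)
next
  assume *: "between u v w"
  obtain q r where qr: "awalk u q v" "length q = gdist u v" "awalk v r w" "length r = gdist v w"
    using assms ex_geodesic by metis
  have "awalk u (q @ r) w" "length (q @ r) = gdist u w"
    using qr * awalk_appendI by (auto simp: between_def)
  moreover have "v \<in> set (pawalk_verts u (q @ r))"
    using set_awalk_verts_append[OF qr(1,3)] hd_in_awalk_verts(1)[OF qr(3)] by simp
  ultimately show "\<exists>p. shortest_path G u p w \<and> v \<in> set (pawalk_verts u p)"
    unfolding shortest_path_iff by blast
qed

lemma strong_resolving_set_iff: "strong_resolving_set G W \<longleftrightarrow> resolving W"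
  unfolding strong_resolving_set_def resolving_def strongly_resolves_def awalk_verts_with_proj_eq
proof (intro conj_cong refl ball_cong imp_cong bex_cong)
  fix u v w assume "W \<subseteq> pverts G" "u \<in> pverts G" "v \<in> pverts G" "w \<in> W"
  then have "w \<in> pverts G" by blast
  then show "((\<exists>p. shortest_path G u p w \<and> v \<in> set (pawalk_verts u p)) \<or>
      (\<exists>p. shortest_path G v p w \<and> u \<in> set (pawalk_verts v p))) \<longleftrightarrow>
      between u v w \<or> between v u w"
    using \<open>u \<in> pverts G\<close> \<open>v \<in> pverts G\<close> by (simp add: on_shortest_path_iff)
qed

text \<open>The minimum is attained because the whole vertex set resolves: for \<open>u\<close> and
  \<open>v\<close> take \<open>w\<close> = \<open>v\<close>.\<close>

lemma ex_resolving: "\<exists>W. resolving W \<and> card W = strong_dim G"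
proof -
  have "resolving (pverts G)"
    unfolding resolving_def between_def using gdist_self by (metis add_0_right subset_refl)
  then have "\<exists>n W. strong_resolving_set G W \<and> card W = n"
    using strong_resolving_set_iff by blast
  then have "\<exists>W. strong_resolving_set G W \<and> card W = strong_dim G"
    unfolding strong_dim_def by (rule LeastI_ex)
  then show ?thesis using strong_resolving_set_iff by simp
qed

lemma strong_dim_le: "resolving W \<Longrightarrow> strong_dim G \<le> card W"
  unfolding strong_dim_def by (rule Least_le) (auto simp: strong_resolving_set_iff)

text \<open>Turns a failure of betweenness into a walk that can be glued with others to a forbidden
  cycle.\<close>

lemma ex_walk_avoiding:
  assumes "u \<in> pverts G" "v \<in> pverts G" "x \<in> pverts G" "\<not> between u x v"
  shows "\<exists>p. awalk u p v \<and> x \<notin> set (pawalk_verts u p)"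
proof -
  obtain p where p: "awalk u p v" "length p = gdist u v" using ex_geodesic assms by metis
  then have "shortest_path G u p v" by (simp add: shortest_path_iff)
  then have "x \<notin> set (pawalk_verts u p)" using on_shortest_path_iff[of u x v] assms by blast
  then show ?thesis using p by blast
qed

end

section \<open>Separation by single vertices in trees\<close>

locale undirected_tree_graph =
  fixes G :: "'a pair_pre_digraph"
  assumes undirected_tree: "undirected_tree G"

sublocale undirected_tree_graph \<subseteq> connected_pair_graph
  using undirected_tree
  by (simp add: undirected_tree_def connected_pair_graph_def connected_pair_graph_axioms_def)

context undirected_tree_graph
begin

text \<open>A walk between two neighbours of \<open>v\<close> that misses \<open>v\<close> shrinks
  to a path, which closes to a cycle through \<open>v\<close>.\<close>

lemma walk_avoiding_neighbours:
  assumes "(v, x) \<in> parcs G" "(v, y) \<in> parcs G" "x \<noteq> y" "awalk x p y"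
  shows "v \<in> set (pawalk_verts x p)"
proof (rule ccontr)
  assume *: "v \<notin> set (pawalk_verts x p)"
  define q where "q = awalk_to_apath p"
  have q: "apath x q y" "set q \<subseteq> set p"
    using assms apath_awalk_to_apath awalk_to_apath_subset unfolding q_def by blast+
  then have qw: "awalk x q y" by (simp add: apath_def)
  have "v \<notin> set (pawalk_verts x q)"
    using * q(2) set_awalk_verts[OF qw] set_awalk_verts[OF assms(4)] by auto
  moreover have yv: "awalk y [(y, v)] v"
    using assms arc_sym in_arcsD1 by (auto simp: awalk_simps)
  then have w: "awalk x (q @ [(y, v)]) v" using qw awalk_appendI by blast
  then have "awalk v ((v, x) # q @ [(y, v)]) v"
    using assms(1) awalk_Cons_iff[of v "(v, x)" "q @ [(y, v)]" v] by simp
  moreover have "pawalk_verts x (q @ [(y, v)]) = pawalk_verts x q @ [v]"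
    using awalk_verts_append[OF w] qw by simp
  moreover have "distinct (pawalk_verts x q)" using q by (simp add: apath_def)
  ultimately have "cycle ((v, x) # q @ [(y, v)])" unfolding cycle_def by auto
  \<comment> \<open>At least one arc inside \<open>q\<close> brings the length to 3 and rules out
    the harmless cycle back and forth along one edge.\<close>
  moreover have "q \<noteq> []" using qw assms(3) awalk_empty_ends by blast
  then have "3 \<le> length ((v, x) # q @ [(y, v)])" by (cases q) auto
  ultimately show False using undirected_tree unfolding undirected_tree_def by blast
qed

lemma between_via:
  assumes "(v, x) \<in> parcs G" "(v, y) \<in> parcs G" "x \<noteq> y" "r \<in> pverts G"
  shows "between x v r \<or> between r v y"
proof (rule ccontr)
  assume "\<not> (between x v r \<or> between r v y)"
  moreover have "v \<in> pverts G" "x \<in> pverts G" "y \<in> pverts G"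
    using assms in_arcsD1 in_arcsD2 by blast+
  ultimately obtain p q where pq: "awalk x p r" "v \<notin> set (pawalk_verts x p)"
    "awalk r q y" "v \<notin> set (pawalk_verts r q)"
    using ex_walk_avoiding assms(4) by meson
  then show False
    using walk_avoiding_neighbours[OF assms(1-3) awalk_appendI[OF pq(1,3)]]
      set_awalk_verts_append[OF pq(1,3)] by simp
qed

lemma between_arc_iff:
  assumes "(v, x) \<in> parcs G" "r \<in> pverts G"
  shows "between x v r \<longleftrightarrow> gdist x r = gdist v r + 1"
  using gdist_arc[OF arc_sym[OF assms(1)]] by (auto simp: between_def)

text \<open>Both axioms come from walks joining two neighbours of \<open>x\<close> without meeting
  \<open>x\<close>. For \<open>bipartite\<close> these are \<open>y\<close> and the neighbour
  \<open>p\<close> of \<open>x\<close> towards \<open>r\<close>.\<close>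

sublocale tree_metric "pverts G" gdist
proof
  fix p q r x assume V: "p \<in> pverts G" "q \<in> pverts G" "r \<in> pverts G" "x \<in> pverts G"
    and pq: "between p x q"
  show "between p x r \<or> between q x r"
  proof (cases "x = p \<or> x = q")
    case True
    then show ?thesis using V gdist_self by (auto simp: between_def)
  next
    case False
    then obtain y z where y: "(x, y) \<in> parcs G" "gdist x p = gdist y p + 1"
      and z: "(x, z) \<in> parcs G" "gdist x q = gdist z q + 1"
      using gdist_step V by metis
    have yz: "y \<in> pverts G" "z \<in> pverts G" using y z in_arcsD2 by auto
    have walk: "\<exists>w. awalk u w v \<and> x \<notin> set (pawalk_verts u w)"
      if "\<not> between u x v" "u \<in> pverts G" "v \<in> pverts G" for u v
      using ex_walk_avoiding that V by blast
    show ?thesis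
    proof (rule ccontr)
      assume *: "\<not> (between p x r \<or> between q x r)"
      \<comment> \<open>A common neighbour towards both \<open>p\<close> and \<open>q\<close> would
        shorten the geodesic through \<open>x\<close> by 2.\<close>
      have "y \<noteq> z"
        using pq y z yz V gdist_triangle[of p y q] by (auto simp: between_def gdist_commute)
      moreover have "\<not> between y x p" "\<not> between q x z"
        using y z yz V between_arc_iff[of x y p] between_arc_iff[of x z q] between_commute[of q x z]
        by auto
      moreover have "\<not> between r x q" using * V between_commute by blast
      \<comment> \<open>The forbidden walk runs from \<open>y\<close> through \<open>p\<close>,
        \<open>r\<close> and \<open>q\<close> to \<open>z\<close>, avoiding \<open>x\<close>
        throughout.\<close>
      ultimately obtain w1 w2 w3 w4 where
        w: "awalk y w1 p" "awalk p w2 r" "awalk r w3 q" "awalk q w4 z" and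
        avoid: "x \<notin> set (pawalk_verts y w1)" "x \<notin> set (pawalk_verts p w2)"
          "x \<notin> set (pawalk_verts r w3)" "x \<notin> set (pawalk_verts q w4)"
        using walk * V yz by meson
      have w34: "awalk r (w3 @ w4) z" "x \<notin> set (pawalk_verts r (w3 @ w4))"
        using w avoid awalk_appendI set_awalk_verts_append[OF w(3,4)] by auto
      have w234: "awalk p (w2 @ w3 @ w4) z" "x \<notin> set (pawalk_verts p (w2 @ w3 @ w4))"
        using w avoid w34 awalk_appendI set_awalk_verts_append[OF w(2) w34(1)] by auto
      have "awalk y (w1 @ w2 @ w3 @ w4) z" "x \<notin> set (pawalk_verts y (w1 @ w2 @ w3 @ w4))"
        using w avoid w234 awalk_appendI set_awalk_verts_append[OF w(1) w234(1)] by auto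
      then show False using walk_avoiding_neighbours[OF y(1) z(1) \<open>y \<noteq> z\<close>] by blast
    qed
  qed
next
  fix r x y assume V: "r \<in> pverts G" "x \<in> pverts G" "y \<in> pverts G" and xy: "gdist x y = 1"
  show "gdist r x \<noteq> gdist r y"
  proof
    assume eq: "gdist r x = gdist r y"
    have "x \<noteq> y" using xy V gdist_self by auto
    then have "x \<noteq> r" using eq V gdist_eq_0 gdist_self by metis
    then obtain p where p: "(x, p) \<in> parcs G" "gdist x r = gdist p r + 1"
      using gdist_step V by metis
    have "p \<in> pverts G" using p in_arcsD2 by auto
    then have "p \<noteq> y" "\<not> between p x r" "\<not> between r x y"
      using p eq V xy by (auto simp: gdist_commute between_def)
    then show False using between_via[OF p(1) arc_if_gdist_1[OF V(2,3) xy]] V by blast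
  qed
qed

end

section \<open>Squares of paths and the threshold strong dimension\<close>

text \<open>Replacing numbers by their ranks closes the gaps. By injectivity, at most
  \<open>K v - K u\<close> vertices have numbers from \<open>K u\<close> up to but excluding
  \<open>K v\<close>, so differences do not grow.\<close>

lemma ex_rank:
  fixes K :: "'a \<Rightarrow> int"
  assumes fin: "finite V" and inj: "inj_on K V"
  obtains \<phi> :: "'a \<Rightarrow> nat" where "bij_betw \<phi> V {..<card V}"
    "\<And>u v. \<lbrakk>u \<in> V; v \<in> V\<rbrakk> \<Longrightarrow> \<bar>int (\<phi> u) - int (\<phi> v)\<bar> \<le> \<bar>K u - K v\<bar>"
proof
  define \<phi> where "\<phi> v = card {w \<in> V. K w < K v}" for v
  have less: "\<phi> u < \<phi> v" if "u \<in> V" "K u < K v" for u v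
    unfolding \<phi>_def using that fin by (intro psubset_card_mono) auto
  have "inj_on \<phi> V"
    by (rule inj_onI) (metis inj inj_onD less less_irrefl linorder_neqE)
  moreover have "\<phi> ` V \<subseteq> {..<card V}"
    unfolding \<phi>_def using fin by (auto intro!: psubset_card_mono)
  then have "\<phi> ` V = {..<card V}"
    using \<open>inj_on \<phi> V\<close> by (intro card_subset_eq) (auto simp: card_image)
  ultimately show "bij_betw \<phi> V {..<card V}" by (simp add: bij_betw_def)
  have le: "\<bar>int (\<phi> u) - int (\<phi> v)\<bar> \<le> \<bar>K u - K v\<bar>" if "u \<in> V" "v \<in> V" "K u \<le> K v" for u v
  proof -
    let ?B = "{w \<in> V. K u \<le> K w \<and> K w < K v}"
    have "{w \<in> V. K w < K v} = {w \<in> V. K w < K u} \<union> ?B" using that by auto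
    then have "\<phi> v = \<phi> u + card ?B"
      unfolding \<phi>_def using fin by (simp add: card_Un_disjoint disjoint_iff)
    moreover have "card ?B = card (K ` ?B)"
      using inj by (intro card_image[symmetric]) (auto simp: inj_on_def)
    moreover have "card (K ` ?B) \<le> card {K u..<K v}" by (intro card_mono) auto
    ultimately show ?thesis using that by simp
  qed
  show "\<bar>int (\<phi> u) - int (\<phi> v)\<bar> \<le> \<bar>K u - K v\<bar>" if "u \<in> V" "v \<in> V" for u v
    using le[of u v] le[of v u] that by linarith
qed

context connected_pair_graph
begin

text \<open>The distance is half the difference of positions, rounded up: an arc advances by at most
  2, and jumps of 2 are available until the target is within reach.\<close>

lemma gdist_square_of_path:
  fixes n :: nat
  assumes bij: "bij_betw \<phi> (pverts G) {..<n}"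
    and arcs: "\<And>u v. \<lbrakk>u \<in> pverts G; v \<in> pverts G\<rbrakk> \<Longrightarrow>
      (u, v) \<in> parcs G \<longleftrightarrow> u \<noteq> v \<and> \<phi> u \<le> \<phi> v + 2 \<and> \<phi> v \<le> \<phi> u + 2"
    and uv: "u \<in> pverts G" "v \<in> pverts G" "\<phi> u \<le> \<phi> v"
  shows "gdist u v = (\<phi> v - \<phi> u + 1) div 2"
proof -
  have "\<phi> v \<le> \<phi> u + 2 * gdist u v" using uv(1,2)
  proof (induction "gdist u v" arbitrary: u)
    case 0
    then show ?case using gdist_eq_0 by simp
  next
    case (Suc k)
    then have "u \<noteq> v" using gdist_self by auto
    then obtain z where z: "(u, z) \<in> parcs G" "gdist u v = gdist z v + 1"
      using gdist_step Suc.prems by metis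
    have zV: "z \<in> pverts G" using z(1) in_arcsD2 by blast
    then have "\<phi> z \<le> \<phi> u + 2" using arcs[OF Suc.prems(1)] z(1) by blast
    moreover have "\<phi> v \<le> \<phi> z + 2 * gdist z v"
      using Suc.hyps(1)[OF _ zV Suc.prems(2)] Suc.hyps(2) z(2) by simp
    ultimately show ?case using z(2) by simp
  qed
  moreover have "2 * gdist u v \<le> \<phi> v - \<phi> u + 1" using uv
  proof (induction "\<phi> v - \<phi> u" arbitrary: u rule: less_induct)
    case less
    show ?case
    proof (cases "u = v")
      case True
      then show ?thesis using gdist_self less.prems by simp
    next
      case neq: False
      then have lt: "\<phi> u < \<phi> v"
        using bij less.prems by (metis bij_betw_def inj_onD le_neq_implies_less)
      show ?thesis
      proof (cases "\<phi> v \<le> \<phi> u + 2")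
        case True
        then have "gdist u v = 1" using arcs[of u v] neq less.prems gdist_arc by simp
        then show ?thesis using lt by simp
      next
        case False
        \<comment> \<open>Position \<open>\<phi> u + 2\<close> lies before \<open>\<phi> v\<close>,
          hence is occupied.\<close>
        have "\<phi> v < n" using bij less.prems(2) by (auto simp: bij_betw_def)
        then have "\<phi> u + 2 \<in> \<phi> ` pverts G"
          using bij False by (simp add: bij_betw_def)
        then obtain z where z: "z \<in> pverts G" "\<phi> z = \<phi> u + 2" by auto
        then have "gdist u z = 1" using arcs[of u z] less.prems gdist_arc by auto
        moreover have "2 * gdist z v \<le> \<phi> v - \<phi> z + 1"
          using less.hyps[of z] less.prems z False by simp
        ultimately show ?thesis
          using gdist_triangle[of u z v] less.prems z False by simp
      qed
    qed
  qed
  ultimately show ?thesis by linarith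
qed

lemma strong_dim_square_of_path_le:
  fixes n :: nat
  assumes bij: "bij_betw \<phi> (pverts G) {..<n}" and "n > 0"
    and arcs: "\<And>u v. \<lbrakk>u \<in> pverts G; v \<in> pverts G\<rbrakk> \<Longrightarrow>
      (u, v) \<in> parcs G \<longleftrightarrow> u \<noteq> v \<and> \<phi> u \<le> \<phi> v + 2 \<and> \<phi> v \<le> \<phi> u + 2"
  shows "strong_dim G \<le> 2"
proof -
  \<comment> \<open>The largest even position below \<open>n\<close>.\<close>
  define m where "m = 2 * ((n - 1) div 2)"
  have "0 \<in> \<phi> ` pverts G" "m \<in> \<phi> ` pverts G"
    using bij \<open>n > 0\<close> by (auto simp: bij_betw_def m_def)
  then obtain a b where ab: "a \<in> pverts G" "\<phi> a = 0" "b \<in> pverts G" "\<phi> b = m" by auto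
  note gd = gdist_square_of_path[OF bij arcs]
  have res: "between v u a \<or> between u v b" if uv: "u \<in> pverts G" "v \<in> pverts G" "\<phi> u < \<phi> v" for u v
  \<comment> \<open>Rounding up twice agrees with rounding up once, as seen from position 0, unless
    \<open>u\<close> is odd and \<open>v\<close> even. In that case \<open>v\<close> is at an even
    distance from \<open>m\<close>, so the route from \<open>u\<close> to \<open>b\<close> through
    \<open>v\<close> loses nothing.\<close>
  proof (cases "even (\<phi> u) \<or> odd (\<phi> v)")
    case True
    then have "(\<phi> u + 1) div 2 + (\<phi> v - \<phi> u + 1) div 2 = (\<phi> v + 1) div 2"
      using uv by (auto elim!: evenE oddE)
    then have "between a u v" using gd[of a u] gd[of u v] gd[of a v] ab uv by (simp add: between_def)
    then show ?thesis using ab uv between_commute by blast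
  next
    case False
    have "\<phi> v < n" using bij uv by (auto simp: bij_betw_def)
    define k where "k = (n - 1) div 2"
    obtain i j where ij: "\<phi> u = 2 * i + 1" "\<phi> v = 2 * j"
      using False by (auto elim!: evenE oddE)
    have "i < j" "j \<le> k" using ij uv(3) \<open>\<phi> v < n\<close> unfolding k_def by linarith+
    moreover from this have "\<phi> v - \<phi> u + 1 = 2 * (j - i)" "m - \<phi> v + 1 = 2 * (k - j) + 1"
      "m - \<phi> u + 1 = 2 * (k - i)"
      using ij unfolding m_def k_def[symmetric] by simp_all
    moreover have "\<phi> v \<le> m" using ij \<open>j \<le> k\<close> by (simp add: m_def k_def)
    ultimately have "between u v b"
      using gd[of u v] gd[of v b] gd[of u b] ab uv by (simp add: between_def)
    then show ?thesis by simp
  qed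
  have "resolving {a, b}"
    unfolding resolving_def
  proof (intro conjI ballI impI)
    fix u v assume uv: "u \<in> pverts G" "v \<in> pverts G" "u \<noteq> v"
    then have "\<phi> u \<noteq> \<phi> v" using bij by (auto simp: bij_betw_def inj_on_def)
    then show "\<exists>w\<in>{a, b}. between u v w \<or> between v u w"
      using res[of u v] res[of v u] uv by (auto simp: neq_iff)
  qed (use ab in auto)
  then have "strong_dim G \<le> card {a, b}" by (rule strong_dim_le)
  \<comment> \<open>Only an inequality, as \<open>a\<close> and \<open>b\<close> coincide for
    \<open>n \<le> 2\<close>.\<close>
  also have "\<dots> \<le> 2" by (simp add: card_insert_if)
  finally show ?thesis .
qed

text \<open>Along a geodesic of \<open>G\<close> from \<open>v\<close> to \<open>w\<close>, the
  \<open>H\<close>-distance \<open>f\<close> to \<open>w\<close> drops by at most 1 per step, so it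
  takes every value from \<open>f v\<close> down to 0. As \<open>f\<close> is injective, the
  geodesic meets every \<open>u\<close> with \<open>f u \<le> f v\<close>.\<close>

lemma strong_dim_spanning_le_1:
  assumes H: "connected_pair_graph H" "pverts H = pverts G" "parcs G \<subseteq> parcs H"
    and "strong_dim H \<le> 1"
  shows "strong_dim G \<le> 1"
proof -
  interpret H: connected_pair_graph H by fact
  obtain W where W: "H.resolving W" "card W = strong_dim H" using H.ex_resolving by blast
  have "finite W"
    using W(1) H.pair_finite_verts finite_subset unfolding H.resolving_def by blast
  have "\<exists>W'. resolving W' \<and> card W' \<le> 1"
  proof (cases "W = {}")
    \<comment> \<open>An empty resolving set means that there are no two distinct vertices, in
      \<open>G\<close> as in \<open>H\<close>.\<close>
    case True
    then have "resolving {}" using W(1) unfolding True H.resolving_def resolving_def by (simp add: H(2))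
    then show ?thesis by auto
  next
    case False
    then have "card W > 0" using \<open>finite W\<close> by (simp add: card_gt_0_iff)
    then have "card W = 1" using W(2) \<open>strong_dim H \<le> 1\<close> by linarith
    then obtain w where w: "W = {w}" by (rule card_1_singletonE)
    have "w \<in> pverts H" using W(1) unfolding w H.resolving_def by blast
    then have wV: "w \<in> pverts G" by (simp add: H(2))
    define f where "f v = H.gdist v w" for v
    have inj: "u = v" if "u \<in> pverts G" "v \<in> pverts G" "f u = f v" for u v
    proof (rule ccontr)
      assume "u \<noteq> v"
      then have "H.between u v w \<or> H.between v u w"
        using W(1) that(1,2) unfolding w H.resolving_def unfolding H(2) by blast
      then have "H.gdist u v = 0 \<or> H.gdist v u = 0"
        using that(3) by (auto simp: f_def H.between_def)
      then show False using \<open>u \<noteq> v\<close> that H(2) H.gdist_eq_0 by metis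
    qed
    have lower: "between v u w" if "u \<in> pverts G" "v \<in> pverts G" "f u \<le> f v" for u v
      using that(2,3)
    proof (induction "gdist v w" arbitrary: v)
      case 0
      then have "v = w" using gdist_eq_0 wV by simp
      then have "f u = f v" using 0 H.gdist_self wV H(2) by (simp add: f_def)
      then have "u = v" using inj that(1) 0 by blast
      then show ?case using gdist_self that(1) by (simp add: between_def)
    next
      case (Suc k)
      show ?case
      proof (cases "u = v")
        case True
        then show ?thesis using gdist_self that(1) by (simp add: between_def)
      next
        case False
        then have "f u < f v" using inj[OF that(1) Suc.prems(1)] Suc.prems(2) by fastforce
        have "v \<noteq> w" using Suc.hyps(2) gdist_self wV by auto
        then obtain z where z: "(v, z) \<in> parcs G" "gdist v w = gdist z w + 1"
          using gdist_step Suc.prems(1) wV by metis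
        have zV: "z \<in> pverts G" using z in_arcsD2 by blast
        have "H.gdist v z = 1" using z H(3) H.gdist_arc by blast
        then have "f v \<le> f z + 1"
          using H.gdist_triangle[of v z w] Suc.prems(1) zV wV H(2) by (simp add: f_def)
        \<comment> \<open>\<open>f u < f v \<le> f z + 1\<close> gives \<open>f u \<le> f z\<close>,
          so the induction hypothesis applies to \<open>z\<close>.\<close>
        then have "between z u w" using Suc.hyps z zV \<open>f u < f v\<close> by simp
        then show ?thesis
          using z gdist_triangle[of v z u] gdist_triangle[of v u w] gdist_arc[OF z(1)]
            Suc.prems(1) zV wV that(1) by (simp add: between_def)
      qed
    qed
    have "resolving {w}"
      unfolding resolving_def
    proof (intro conjI ballI impI)
      fix u v assume "u \<in> pverts G" "v \<in> pverts G"
      then show "\<exists>x\<in>{w}. between u v x \<or> between v u x"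
        using lower[of u v] lower[of v u] le_cases[of "f u" "f v"] by blast
    qed (use wV in simp)
    then show ?thesis by auto
  qed
  then show ?thesis using strong_dim_le by (meson le_trans)
qed

end

theorem theorem6p3:
  fixes T :: "'a pair_pre_digraph"
  assumes "undirected_tree T"
    and "strong_dim T = 3"
  shows "threshold_strong_dim T = 2"
proof -
  interpret T: undirected_tree_graph T using assms(1) by unfold_locales
  have spanning_conn: "connected_pair_graph H" "pverts H = pverts T" "parcs T \<subseteq> parcs H"
    if "pair_graph H" "spanning (with_proj T) (with_proj H)" for H
  proof -
    interpret H: pair_graph H by fact
    show "connected_pair_graph H"
      using H.connected_spanning_imp_connected[OF that(2) T.conn] by unfold_locales
    show "pverts H = pverts T" "parcs T \<subseteq> parcs H"
      using that(2) by (auto simp: spanning_def subgraph_def)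
  qed
  have ge_2: "2 \<le> strong_dim H" if "pair_graph H" "spanning (with_proj T) (with_proj H)" for H
    using T.strong_dim_spanning_le_1[OF spanning_conn[OF that]] assms(2) by linarith
  obtain W where W: "T.resolving W" "card W = 3" using T.ex_resolving assms(2) by auto
  then obtain w1 w2 w3 where "W = {w1, w2, w3}" by (auto simp: card_3_iff)
  then have "\<exists>K :: 'a \<Rightarrow> int. inj_on K (pverts T) \<and>
      (\<forall>u \<in> pverts T. \<forall>v \<in> pverts T. T.gdist u v = 1 \<longrightarrow> \<bar>K u - K v\<bar> \<le> 2)"
    using T.ex_bandwidth_2_numbering[OF T.pair_finite_verts] W(1) by blast
  then obtain K :: "'a \<Rightarrow> int" where K: "inj_on K (pverts T)"
    "\<And>u v. \<lbrakk>u \<in> pverts T; v \<in> pverts T; T.gdist u v = 1\<rbrakk> \<Longrightarrow> \<bar>K u - K v\<bar> \<le> 2" by blast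
  define n where "n = card (pverts T)"
  obtain \<phi> :: "'a \<Rightarrow> nat" where bij: "bij_betw \<phi> (pverts T) {..<n}"
    and \<phi>: "\<And>u v. \<lbrakk>u \<in> pverts T; v \<in> pverts T\<rbrakk> \<Longrightarrow> \<bar>int (\<phi> u) - int (\<phi> v)\<bar> \<le> \<bar>K u - K v\<bar>"
    using ex_rank[OF T.pair_finite_verts K(1)] unfolding n_def by blast
  \<comment> \<open>The square of the path that \<open>\<phi>\<close> lays through the vertices;
    tree edges survive because ranks differ no more than the numbers \<open>K\<close>.\<close>
  define H where "H = \<lparr>pverts = pverts T, parcs = {(u, v). u \<in> pverts T \<and> v \<in> pverts T \<and>
      u \<noteq> v \<and> \<phi> u \<le> \<phi> v + 2 \<and> \<phi> v \<le> \<phi> u + 2}\<rparr>"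
  have arcs: "(u, v) \<in> parcs T \<Longrightarrow> (u, v) \<in> parcs H" for u v
    using T.in_arcsD1[of u v] T.in_arcsD2[of u v] T.pair_no_loops[of "(u, v)"]
      K(2)[of u v] \<phi>[of u v] T.gdist_arc[of u v] by (auto simp: H_def)
  have H: "pair_graph H"
  proof
    have "parcs H \<subseteq> pverts T \<times> pverts T" by (auto simp: H_def)
    then show "finite (parcs H)" using T.pair_finite_verts finite_subset by blast
    show "symmetric (with_proj H)" by (auto simp: symmetric_def sym_def H_def)
  qed (use T.pair_finite_verts in \<open>auto simp: H_def\<close>)
  have spanning: "spanning (with_proj T) (with_proj H)"
  proof -
    interpret H: pair_graph H by fact
    show ?thesis unfolding spanning_def subgraph_def
      using arcs T.wf_digraph_axioms H.wf_digraph_axioms by (auto simp: H_def)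
  qed
  interpret H: connected_pair_graph H using spanning_conn(1)[OF H spanning] .
  have "n > 0"
    using W T.pair_finite_verts unfolding n_def T.resolving_def by (auto simp: card_gt_0_iff)
  then have "strong_dim H \<le> 2"
    using bij by (intro H.strong_dim_square_of_path_le[of \<phi> n]) (auto simp: H_def)
  then have "strong_dim H = 2" using ge_2[OF H spanning] by simp
  then show ?thesis
    unfolding threshold_strong_dim_def using H spanning ge_2 by (intro Least_equality) blast+
qed

end
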